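(* Let $p\equiv 1 \pmod 6$ be a prime, and let $f$ be the order of $5$ in $(\mathbb{Z}/p\mathbb{Z})^\times$; suppose that $3\mid f$. Let $N$ be a friend of $20$. If $v_5(N)\equiv -1 \pmod f$, then there exists an odd prime divisor $q$ of $N$ such that $v_q(N)\not\equiv -1 \pmod f$.
   Context: For a positive integer $n$, $\sigma(n)$ denotes the sum of the positive divisors of $n$, and the abundancy index of $n$ is $I(n)=\sigma(n)/n$. A positive integer $N>20$ is called a friend of $20$ if $I(N)=I(20)=21/10$. For a prime $p$, $v_p(N)=k$ means $p^k\mid N$ but $p^{k+1}\nmid N$. *)

theory Defs
  imports Complex_Main "HOL-Number_Theory.Number_Theory"
begin

definition divisor_sum :: "nat \<Rightarrow> nat" where
  "divisor_sum n = (\<Sum>d | d dvd n. d)"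

definition abundancy :: "nat \<Rightarrow> rat" where
  "abundancy n = of_nat (divisor_sum n) / of_nat n"

definition friend_of_20 :: "nat \<Rightarrow> bool" where
  "friend_of_20 N \<longleftrightarrow> N > 20 \<and> abundancy N = abundancy 20"

lemma abundancy_20: "abundancy 20 = 21 / 10"
proof -
  have "{d::nat. d dvd 20} = Set.filter (\<lambda>d. d dvd 20) {1..20}"
    by (auto dest: dvd_imp_le intro!: Suc_leI intro: Nat.gr0I)
  also have "\<dots> = {1, 2, 4, 5, 10, 20}"
    by code_simp
  finally show ?thesis
    by (simp add: abundancy_def divisor_sum_def)
qed

end

theory Submission
  imports Defs
begin

text \<open>
  Suppose that \<open>f\<close> divides \<open>v\<^sub>q(N) + 1\<close> for all odd primes \<open>q\<close> dividing \<open>N\<close>, so that all these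
  exponents are congruent to 2 modulo 3. Since \<open>I\<close> is monotone under divisibility and
  \<open>I(100) > 21/10\<close>, we get \<open>N = 2 m\<close> with \<open>m\<close> odd and \<open>5 \<sigma>(m) = 7 m\<close>; since \<open>I(9) > 7/5\<close>, the prime
  3 does not divide \<open>m\<close>, hence it does not divide \<open>\<sigma>(m)\<close>. But \<open>p\<close> divides \<open>\<sigma>(5\<^sup>v)\<close> for
  \<open>v = v\<^sub>5(m)\<close>, so \<open>p = 7\<close> or \<open>p\<close> divides \<open>m\<close>. In the first case \<open>f = 6\<close>, so that
  \<open>1 + 5\<close> divides \<open>\<sigma>(5\<^sup>v)\<close>; in the second case \<open>\<sigma>(p\<^sup>w) \<equiv> w + 1 \<equiv> 0\<close> modulo 3 for
  \<open>w = v\<^sub>p(m)\<close>. Either way 3 divides \<open>\<sigma>(m)\<close>.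
\<close>

lemma divisor_sum_mult_coprime:
  assumes "coprime a b"
  shows "divisor_sum (a * b) = divisor_sum a * divisor_sum b"
proof -
  have inj: "inj_on (\<lambda>(x, y). x * y) ({d. d dvd a} \<times> {d. d dvd b})"
  proof (rule inj_onI, clarsimp)
    fix x y x' y' :: nat
    assume dvd: "x dvd a" "y dvd b" "x' dvd a" "y' dvd b" and eq: "x * y = x' * y'"
    \<comment> \<open>Coprimality to \<open>y'\<close> turns \<open>x dvd x' * y'\<close> into
      \<open>x dvd x'\<close>; the other three divisibilities arise in the same way.\<close>
    have "coprime x y'" "coprime x' y"
      using dvd assms by (meson coprime_divisors)+
    then have "x dvd x'" "x' dvd x" "y dvd y'" "y' dvd y"
      using eq by (metis coprime_dvd_mult_left_iff coprime_dvd_mult_right_iff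
          coprime_commute dvd_triv_left dvd_triv_right)+
    then show "x = x' \<and> y = y'"
      by (simp add: dvd_antisym)
  qed
  have img: "(\<lambda>(x, y). x * y) ` ({d. d dvd a} \<times> {d. d dvd b}) = {d. d dvd a * b}"
    by (force simp: mult_dvd_mono dest: division_decomp)
  have "divisor_sum (a * b) = (\<Sum>(x, y)\<in>{d. d dvd a} \<times> {d. d dvd b}. x * y)"
    unfolding divisor_sum_def img[symmetric]
    by (subst sum.reindex[OF inj]) (simp add: case_prod_unfold)
  then show ?thesis
    by (simp add: divisor_sum_def sum_product sum.cartesian_product)
qed

lemma divisor_sum_prime_power:
  assumes "prime q"
  shows "divisor_sum (q ^ k) = (\<Sum>i\<le>k. q ^ i)"
proof -
  have eq: "{d. d dvd q ^ k} = (\<lambda>i. q ^ i) ` {..k}"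
    using divides_primepow_nat[OF assms] by auto
  have "inj_on (\<lambda>i. q ^ i) {..k}"
    using prime_gt_1_nat[OF assms] by (auto intro: inj_onI)
  then show ?thesis
    unfolding divisor_sum_def eq by (simp add: sum.reindex)
qed

text \<open>Multiplication by \<open>c\<close> injects the divisors of \<open>a\<close> into those
  of \<open>a * c\<close>. After division by \<open>a * c\<close> this is the monotonicity of the
  abundancy index.\<close>

lemma divisor_sum_mult_ge:
  assumes "a * c > 0"
  shows "c * divisor_sum a \<le> divisor_sum (a * c)"
proof -
  have "c * divisor_sum a = (\<Sum>d\<in>(\<lambda>d. c * d) ` {d. d dvd a}. d)"
    using assms by (simp add: divisor_sum_def sum_distrib_left sum.reindex inj_on_def)
  also have "\<dots> \<le> divisor_sum (a * c)"
    unfolding divisor_sum_def using assms by (intro sum_mono2) (auto simp: mult.commute)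
  finally show ?thesis .
qed

lemma divisor_sum_primepart_dvd:
  assumes "prime q" "n > 0"
  shows "divisor_sum (q ^ multiplicity q n) dvd divisor_sum n"
proof -
  obtain y where y: "n = q ^ multiplicity q n * y" "\<not> q dvd y"
    using assms multiplicity_decompose'[of n q] by (metis not_gr_zero not_prime_unit)
  then have "coprime (q ^ multiplicity q n) y"
    using assms by (simp add: prime_imp_coprime)
  then show ?thesis
    using y(1) divisor_sum_mult_coprime dvd_triv_left by metis
qed

lemma cong_geometric_sum_nat:
  "[x = 1] (mod n) \<Longrightarrow> [(\<Sum>i\<le>k. x ^ i) = k + 1] (mod n)" for x n k :: nat
  using cong_sum[of "{..k}" "\<lambda>i. x ^ i" "\<lambda>_. 1" n] cong_pow[of x 1 n] by simp

text \<open>Passes from integer congruences to divisibility of naturals, the form that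
  \<open>ord_divides\<close> produces.\<close>

lemma cong_minus_one_iff_dvd_Suc: "[int k = - 1] (mod int f) \<longleftrightarrow> f dvd Suc k"
  by (simp add: cong_iff_dvd_diff flip: int_dvd_int_iff of_nat_Suc add.commute)

text \<open>The usual closed form, cleared of division and of truncated subtraction.\<close>

lemma geometric_sum_5: "4 * (\<Sum>i\<le>k. 5 ^ i) + 1 = (5 ^ Suc k :: nat)"
  by (induction k) auto

lemma divisor_sum_prime_square: "prime q \<Longrightarrow> divisor_sum (q ^ 2) = 1 + q + q ^ 2"
  by (simp add: divisor_sum_prime_power atMost_nat_numeral)

lemma divisor_sum_9: "divisor_sum 9 = 13"
  using divisor_sum_prime_square[of 3] by simp

lemma divisor_sum_100: "divisor_sum 100 = 217"
proof -
  have "coprime (2 ^ 2 :: nat) (5 ^ 2)"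
    by (simp only: coprime_power_left_iff coprime_power_right_iff) (simp add: primes_coprime)
  from divisor_sum_mult_coprime[OF this] show ?thesis
    using divisor_sum_prime_square[of 2] divisor_sum_prime_square[of 5] by simp
qed

lemma friend_of_20_divisor_sum:
  assumes "friend_of_20 N"
  shows "10 * divisor_sum N = 21 * N"
proof -
  have "abundancy N = 21 / 10" "N > 0"
    using assms by (auto simp: friend_of_20_def abundancy_20)
  then have "of_nat (10 * divisor_sum N) = (of_nat (21 * N) :: rat)"
    by (simp add: abundancy_def field_simps)
  then show ?thesis
    by (simp only: of_nat_eq_iff)
qed

text \<open>The order divides 6, and if odd it would divide 3; but 125 is -1 modulo 7.\<close>

lemma ord_7_5_even:
  assumes "3 dvd ord 7 (5 :: nat)"
  shows "even (ord 7 (5 :: nat))"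
proof (rule ccontr)
  assume odd: "odd (ord 7 (5 :: nat))"
  have "ord 7 (5 :: nat) dvd 2 * 3"
    unfolding ord_divides[symmetric] by (simp add: cong_def)
  moreover have "coprime (ord 7 (5 :: nat)) 2"
    using odd by (simp add: coprime_right_2_iff_odd)
  ultimately have "ord 7 (5 :: nat) dvd 3"
    by (simp only: coprime_dvd_mult_right_iff)
  then have "[5 ^ 3 = 1] (mod (7 :: nat))"
    by (simp only: ord_divides)
  then show False
    by (simp add: cong_def)
qed

theorem theorem4:
  fixes p f N :: nat
  assumes "prime p" and "[p = 1] (mod 6)"
    and "f = ord p 5" and "3 dvd f"
    and "friend_of_20 N"
    and "[int (multiplicity 5 N) = - 1] (mod int f)"
  shows "\<exists>q. prime q \<and> odd q \<and> q dvd N \<and> \<not> [int (multiplicity q N) = - 1] (mod int f)"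
proof (rule ccontr)
  assume "\<not> ?thesis"
  then have mult: "f dvd Suc (multiplicity q N)" if "prime q" "odd q" "q dvd N" for q
    using that by (auto simp: cong_minus_one_iff_dvd_Suc)
  have sum_N: "10 * divisor_sum N = 21 * N" and N_pos: "N > 0"
    using assms(5) friend_of_20_divisor_sum by (auto simp: friend_of_20_def)
  have sq: "q ^ 2 dvd N" if "prime q" "odd q" "q dvd N" for q
  proof -
    have "3 dvd Suc (multiplicity q N)"
      using mult[OF that] assms(4) dvd_trans by blast
    \<comment> \<open>Multiplicity 0 or 1 would make 3 divide 1 or 2.\<close>
    then have "2 \<le> multiplicity q N"
      by (auto dest: dvd_imp_le)
    then show ?thesis
      by (rule multiplicity_dvd')
  qed
  have "10 dvd N"
    using sum_N by presburger
  then have "2 dvd N" "5 dvd N"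
    by presburger+
  then obtain m where m: "N = 2 * m"
    by blast
  have "25 dvd N"
    using sq[of 5] \<open>5 dvd N\<close> by simp
  have "odd m"
  proof
    assume "even m"
    then have "100 dvd N"
      using \<open>25 dvd N\<close> m by presburger
    then obtain c where "N = 100 * c"
      by blast
    \<comment> \<open>The two bounds clash: \<open>217 * c\<close> is at most
      \<open>divisor_sum N\<close>, which equals \<open>210 * c\<close>.\<close>
    then show False
      using divisor_sum_mult_ge[of 100 c] sum_N N_pos divisor_sum_100 by simp
  qed
  have "divisor_sum 2 = 3"
    using divisor_sum_prime_power[of 2 1] by simp
  then have sum_m: "5 * divisor_sum m = 7 * m"
    using divisor_sum_mult_coprime[of 2 m] \<open>odd m\<close> sum_N m by simp
  have m_pos: "m > 0"
    using N_pos m by simp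
  have mult_m: "f dvd Suc (multiplicity q m)" if "prime q" "odd q" "q dvd m" for q
  proof -
    have "\<not> q dvd 2"
      using that(1,2) primes_dvd_imp_eq two_is_prime_nat by blast
    then have "multiplicity q N = multiplicity q m"
      using that(1) m m_pos
      by (simp add: prime_elem_multiplicity_mult_distrib not_dvd_imp_multiplicity_0)
    then show ?thesis
      using mult[of q] that m by simp
  qed
  have not3: "\<not> 3 dvd m"
  proof
    assume "3 dvd m"
    then have "9 dvd N"
      using sq[of 3] m by simp
    then have "9 dvd m"
      using m by presburger
    then obtain c where "m = 9 * c"
      by blast
    \<comment> \<open>Here \<open>13 * c\<close> is at most \<open>divisor_sum m\<close>, so 65 c
      would be at most 63 c.\<close>
    then show False
      using divisor_sum_mult_ge[of 9 c] sum_m m_pos divisor_sum_9 by simp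
  qed
  then have not3': "\<not> 3 dvd divisor_sum m"
    using sum_m by presburger
  define v where "v = multiplicity 5 m"
  have "5 dvd m"
    using \<open>5 dvd N\<close> m by presburger
  then have "f dvd Suc v"
    unfolding v_def by (intro mult_m) auto
  have sum5: "4 * divisor_sum (5 ^ v) + 1 = 5 ^ Suc v"
    using geometric_sum_5 divisor_sum_prime_power[of 5 v] by simp
  have dvd5: "divisor_sum (5 ^ v) dvd divisor_sum m"
    unfolding v_def using m_pos by (intro divisor_sum_primepart_dvd) auto
  have p_mod: "p mod 6 = 1"
    using assms(2) by (simp add: cong_def)
  have "odd p"
    using p_mod by presburger
  have "[5 ^ Suc v = 1] (mod p)"
    using \<open>f dvd Suc v\<close> assms(3) by (simp only: ord_divides)
  \<comment> \<open>Writing \<open>0 + 1\<close> lets the summand 1 cancel; the factor 4 is then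
    split as \<open>2 * 2\<close> and removed because \<open>p\<close> is an odd prime.\<close>
  then have "[4 * divisor_sum (5 ^ v) + 1 = 0 + 1] (mod p)"
    unfolding sum5 by simp
  then have "p dvd 2 * 2 * divisor_sum (5 ^ v)"
    unfolding cong_add_rcancel_nat cong_0_iff by simp
  moreover have "\<not> p dvd 2"
    using assms(1) \<open>odd p\<close> primes_dvd_imp_eq two_is_prime_nat by blast
  ultimately have "p dvd divisor_sum (5 ^ v)"
    using assms(1) by (simp only: prime_dvd_mult_iff) blast
  then have "p dvd 7 * m"
    using dvd5 sum_m by (metis dvd_mult dvd_trans)
  moreover have "prime (7 :: nat)"
    by simp
  ultimately consider "p = 7" | "p dvd m"
    using assms(1) primes_dvd_imp_eq prime_dvd_mult_iff by blast
  then show False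
  proof cases
    case 1
    \<comment> \<open>Since 5 is -1 modulo 3, an even exponent gives 1, so 3 divides
      \<open>4 * divisor_sum (5 ^ v)\<close>.\<close>
    then have "even (Suc v)"
      using ord_7_5_even assms(3,4) \<open>f dvd Suc v\<close> dvd_trans by blast
    then obtain j where "Suc v = 2 * j"
      by blast
    moreover have "[25 ^ j = 1 ^ j] (mod (3 :: nat))"
      by (intro cong_pow) (simp add: cong_def)
    ultimately have "(5 ^ Suc v) mod 3 = (1 :: nat)"
      by (simp only: power_mult) (simp add: cong_def)
    then have "3 dvd divisor_sum (5 ^ v)"
      using sum5 by presburger
    then show False
      using dvd5 not3' dvd_trans by blast
  next
    case 2
    define w where "w = multiplicity p m"
    have "3 dvd w + 1"
      using mult_m[OF assms(1) \<open>odd p\<close> 2] assms(4) dvd_trans unfolding w_def by auto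
    moreover have "[p = 1] (mod 3)"
      using p_mod unfolding cong_def by presburger
    \<comment> \<open>The sum has \<open>w + 1\<close> terms, each 1 modulo 3.\<close>
    ultimately have "3 dvd divisor_sum (p ^ w)"
      using cong_geometric_sum_nat cong_dvd_iff
      unfolding divisor_sum_prime_power[OF assms(1)] by blast
    then show False
      using divisor_sum_primepart_dvd[OF assms(1) m_pos] not3' dvd_trans
      unfolding w_def by blast
  qed
qed

end
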